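(* Let $M\in\mathcal{M}^{+}$ be cluster-positive. (a) $M$ satisfies (A) if and only if $C(M)<4$ or $\mathrm{Sk}(M)$ belongs to $\Gamma(p,p,2)$, $\Gamma(p,2,p)$, or $\Gamma(2,p,p)$ for some $p\geq 2$. (b) $M$ satisfies (B) if and only if $C(M)=4$ and $\mathrm{Sk}(M)$ belongs to none of $\Gamma(p,p,2)$, $\Gamma(p,2,p)$, $\Gamma(2,p,p)$ for any $p\geq 2$. Moreover, in this case there is a unique infinite sequence $M=M_0\overset{\gamma_{t_1}}{\mapsto}M_1\overset{\gamma_{t_2}}{\mapsto}M_2\overset{\gamma_{t_3}}{\mapsto}\cdots$ with $M_{i-1}\not\leq M_i$ for all $i\geq1$, and it converges to a fixed point $L(M)$ of $\Gamma$ (i.e. $\gamma_k(L(M))=L(M)$ for $k=1,2,3$).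
   Context: $\mathcal{M}^{+}$ is the set of $2\times 3$ arrays $M=\begin{pmatrix} x & y & z\\ x' & y' & z'\end{pmatrix}$ of positive reals with $xyz=x'y'z'$. The maps are $\gamma_1(M)=\begin{pmatrix} y'z'-x & y & z\\ yz-x' & y' & z'\end{pmatrix}$, $\gamma_2(M)=\begin{pmatrix} x & z'x'-y & z\\ x' & zx-y' & z'\end{pmatrix}$, $\gamma_3(M)=\begin{pmatrix} x & y & x'y'-z\\ x' & y' & xy-z'\end{pmatrix}$; on triples $S=(p,q,r)$: $\gamma_1(S)=(qr-p,q,r)$, $\gamma_2(S)=(p,rp-q,r)$, $\gamma_3(S)=(p,q,pq-r)$. $\Gamma(\cdot)$ denotes the set of images under finite compositions of $\gamma_k$ with consecutive indices distinct; a positive element is cluster-positive if all elements of its orbit have all entries positive. $\leq$ is the entrywise order. $\mathrm{Sk}(M)=(\sqrt{xx'},\sqrt{yy'},\sqrt{zz'})$ for $M\in\mathcal{M}^{+}$, and $C(M)=xx'+yy'+zz'-xyz$ (equal to $C(\mathrm{Sk}(M))$ with $C(p,q,r)=p^2+q^2+r^2-pqr$). A positive triple $S$ satisfies (M1) if $S\leq\gamma_i(S)$ for all $i=1,2,3$, and (M2) if this holds for precisely two indices $i$. For cluster-positive $S$: (A) means $\Gamma(S)$ has a unique element satisfying (M1); (B) means every element of $\Gamma(S)$ satisfies (M2). A cluster-positive $M$ satisfies (A), resp. (B), if $\mathrm{Sk}(M)$ does. Every cluster-positive element satisfies exactly one of (A), (B), and has $C\leq 4$. *)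

theory Defs
  imports "HOL-Analysis.Analysis"
begin

text \<open>
  Arrays are elements of \<open>real ^ 3 ^ 2\<close> (two rows of length three, rows addressed first) and
  triples are elements of \<open>real ^ 3\<close>; the library order \<open>\<le>\<close> on both types is the entrywise one.
  The index \<open>k\<close> of \<open>\<gamma>\<^sub>k\<close> has the three-element type \<open>3\<close>, whose elements are \<open>1\<close>, \<open>2\<close> and \<open>3 = 0\<close>.
\<close>

definition Mplus :: "(real ^ 3 ^ 2) set" where
  "Mplus = {M. (\<forall>i j. 0 < M $ i $ j) \<and>
               M $ 1 $ 1 * M $ 1 $ 2 * M $ 1 $ 3 = M $ 2 $ 1 * M $ 2 $ 2 * M $ 2 $ 3}"

definition pos_array :: "real ^ 3 ^ 2 \<Rightarrow> bool" where
  "pos_array M \<longleftrightarrow> (\<forall>i j. 0 < M $ i $ j)"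

definition pos_triple :: "real ^ 3 \<Rightarrow> bool" where
  "pos_triple S \<longleftrightarrow> (\<forall>i. 0 < S $ i)"

definition gamma_array :: "3 \<Rightarrow> real ^ 3 ^ 2 \<Rightarrow> real ^ 3 ^ 2" where
  "gamma_array k M =
    (let x  = M $ 1 $ 1; y  = M $ 1 $ 2; z  = M $ 1 $ 3;
         x' = M $ 2 $ 1; y' = M $ 2 $ 2; z' = M $ 2 $ 3
     in if k = 1 then vector [vector [y' * z' - x, y, z], vector [y * z - x', y', z']]
        else if k = 2 then vector [vector [x, z' * x' - y, z], vector [x', z * x - y', z']]
        else vector [vector [x, y, x' * y' - z], vector [x', y', x * y - z']])"

definition gamma_triple :: "3 \<Rightarrow> real ^ 3 \<Rightarrow> real ^ 3" where
  "gamma_triple k S =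
    (let p = S $ 1; q = S $ 2; r = S $ 3
     in if k = 1 then vector [q * r - p, q, r]
        else if k = 2 then vector [p, r * p - q, r]
        else vector [p, q, p * q - r])"

text \<open>
  \<open>orbit_of g s\<close> is \<open>\<Gamma>(s)\<close> for the family of maps \<open>g\<close>: a list \<open>[k\<^sub>1, \<dots>, k\<^sub>n]\<close> without equal
  neighbours stands for the composition \<open>g k\<^sub>1 \<circ> \<dots> \<circ> g k\<^sub>n\<close>, the empty list for the identity.
\<close>

definition orbit_of :: "(3 \<Rightarrow> 'a \<Rightarrow> 'a) \<Rightarrow> 'a \<Rightarrow> 'a set" where
  "orbit_of g s = {foldr g ks s | ks. distinct_adj ks}"

abbreviation Gamma_array :: "real ^ 3 ^ 2 \<Rightarrow> (real ^ 3 ^ 2) set" where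
  "Gamma_array \<equiv> orbit_of gamma_array"

abbreviation Gamma_triple :: "real ^ 3 \<Rightarrow> (real ^ 3) set" where
  "Gamma_triple \<equiv> orbit_of gamma_triple"

definition cluster_positive_array :: "real ^ 3 ^ 2 \<Rightarrow> bool" where
  "cluster_positive_array M \<longleftrightarrow> M \<in> Mplus \<and> (\<forall>N \<in> Gamma_array M. pos_array N)"

definition cluster_positive_triple :: "real ^ 3 \<Rightarrow> bool" where
  "cluster_positive_triple S \<longleftrightarrow> pos_triple S \<and> (\<forall>T \<in> Gamma_triple S. pos_triple T)"

definition Sk :: "real ^ 3 ^ 2 \<Rightarrow> real ^ 3" where
  "Sk M = vector [sqrt (M $ 1 $ 1 * M $ 2 $ 1),
                  sqrt (M $ 1 $ 2 * M $ 2 $ 2),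
                  sqrt (M $ 1 $ 3 * M $ 2 $ 3)]"

definition markov_C :: "real ^ 3 ^ 2 \<Rightarrow> real" where
  "markov_C M = M $ 1 $ 1 * M $ 2 $ 1 + M $ 1 $ 2 * M $ 2 $ 2 + M $ 1 $ 3 * M $ 2 $ 3
                - M $ 1 $ 1 * M $ 1 $ 2 * M $ 1 $ 3"

definition M1 :: "real ^ 3 \<Rightarrow> bool" where
  "M1 S \<longleftrightarrow> pos_triple S \<and> (\<forall>i. S \<le> gamma_triple i S)"

definition M2 :: "real ^ 3 \<Rightarrow> bool" where
  "M2 S \<longleftrightarrow> pos_triple S \<and> card {i. S \<le> gamma_triple i S} = 2"

definition cond_A_triple :: "real ^ 3 \<Rightarrow> bool" where
  "cond_A_triple S \<longleftrightarrow> cluster_positive_triple S \<and> (\<exists>!T. T \<in> Gamma_triple S \<and> M1 T)"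

definition cond_B_triple :: "real ^ 3 \<Rightarrow> bool" where
  "cond_B_triple S \<longleftrightarrow> cluster_positive_triple S \<and> (\<forall>T \<in> Gamma_triple S. M2 T)"

definition cond_A :: "real ^ 3 ^ 2 \<Rightarrow> bool" where
  "cond_A M \<longleftrightarrow> cluster_positive_array M \<and> cond_A_triple (Sk M)"

definition cond_B :: "real ^ 3 ^ 2 \<Rightarrow> bool" where
  "cond_B M \<longleftrightarrow> cluster_positive_array M \<and> cond_B_triple (Sk M)"

text \<open>
  The infinite paths \<open>M = N 0 \<mapsto> N 1 \<mapsto> N 2 \<mapsto> \<dots>\<close> none of whose steps is \<open>\<le>\<close>-increasing.
  The step from \<open>N i\<close> to \<open>N (Suc i)\<close> carries the label \<open>t i\<close>, so \<open>t i\<close> is \<open>t\<^sub>i\<^sub>+\<^sub>1\<close> in the usual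
  numbering by target.
\<close>

definition descending_path ::
  "real ^ 3 ^ 2 \<Rightarrow> (nat \<Rightarrow> real ^ 3 ^ 2) \<Rightarrow> (nat \<Rightarrow> 3) \<Rightarrow> bool" where
  "descending_path M N t \<longleftrightarrow>
     N 0 = M \<and> (\<forall>i. N (Suc i) = gamma_array (t i) (N i) \<and> \<not> N i \<le> N (Suc i))"

end

theory Submission
  imports Defs
begin

text \<open>
  The quotients \<open>M\<^sub>i\<^sub>j / Sk(M)\<^sub>j\<close> are invariant under the maps, so an array moves
  exactly like its triple \<open>Sk M\<close> with columns rescaled by constants, and everything reduces to triples.
  Alternating two of the maps turns the third entry \<open>r\<close> into the coefficient of the positive
  recurrence \<open>u'' = r u' - u\<close>, which forces \<open>r \<ge> 2\<close>. Once all entries are at least \<open>2\<close>, at most one of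
  the three maps decreases a triple, and a step that increases strictly can only be continued
  (without backtracking) by strictly increasing steps; hence (M1) is attained at most once in an orbit.
  A triple with (M1) has \<open>C \<le> 4\<close>, with equality only for the permutations of \<open>(2, p, p)\<close>.
  If (M1) is never attained, there is an infinite descent; it converges, its limit is fixed by every map
  used infinitely often, and if some map were used only finitely often the descent would
  contain a permutation of \<open>(2, p, p)\<close>. So the limit is \<open>(2, 2, 2)\<close> and \<open>C = 4\<close>.
\<close>

text \<open>Adding \<open>1\<close> in the index type \<open>3\<close> is the cyclic shift, so \<open>k\<close>, \<open>k + 1\<close>, \<open>k + 2\<close> are the three indices.\<close>

lemma three_arith:
  "(1::3) + 1 = 2" "(1::3) + 2 = 3" "(2::3) + 1 = 3" "(2::3) + 2 = 1" "(3::3) + 1 = 1" "(3::3) + 2 = 2"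
  by simp_all

lemma shift_neq: "k + 1 \<noteq> k" "k + 2 \<noteq> k" "k + 1 \<noteq> k + 2" for k :: 3
  by simp_all

lemma shift_shift: "k + 1 + 1 = k + 2" "k + 1 + 2 = k" "k + 2 + 1 = k" "k + 2 + 2 = k + 1" for k :: 3
  using exhaust_3[of k] by auto

lemma forall_3_shift: "(\<forall>i. P i) \<longleftrightarrow> P k \<and> P (k + 1) \<and> P (k + 2)" for k :: 3
  using exhaust_3[of k] by (elim disjE) (simp_all only: forall_3 three_arith, auto)

section \<open>Entrywise formulas for the maps\<close>

lemma gamma_triple_nth:
  "gamma_triple k S $ i = (if i = k then S $ (k + 1) * S $ (k + 2) - S $ k else S $ i)"
proof -
  have *: "(4::3) = 1" "(5::3) = 2" by simp_all
  show ?thesis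
    using exhaust_3[of k] exhaust_3[of i] by (auto simp: gamma_triple_def Let_def *)
qed

text \<open>In the index type \<open>2\<close> the index \<open>i + 1\<close> is the other row, so
  one formula covers both rows.\<close>

lemma gamma_array_nth:
  "gamma_array k M $ i $ j =
    (if j = k then M $ (i + 1) $ (k + 1) * M $ (i + 1) $ (k + 2) - M $ i $ k else M $ i $ j)"
proof -
  have *: "(4::3) = 1" "(5::3) = 2" "(3::2) = 1" by simp_all
  show ?thesis
    using exhaust_3[of k] exhaust_3[of j] exhaust_2[of i]
    by (auto simp: gamma_array_def Let_def *)
qed

section \<open>Involutivity, the entrywise order and orbits\<close>

lemma gamma_triple_invol: "gamma_triple k (gamma_triple k S) = S"
  by (simp add: vec_eq_iff gamma_triple_nth shift_neq)

lemma gamma_array_invol: "gamma_array k (gamma_array k M) = M"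
  by (simp add: vec_eq_iff gamma_array_nth shift_neq)

lemma le_gamma_triple_iff:
  "S \<le> gamma_triple k S \<longleftrightarrow> 2 * S $ k \<le> S $ (k + 1) * S $ (k + 2)"
  by (auto simp: less_eq_vec_def gamma_triple_nth)

text \<open>Only one entry changes, so a triple and its image are always comparable.\<close>

lemma gamma_triple_le:
  assumes "\<not> S \<le> gamma_triple k S"
  shows "gamma_triple k S \<le> S"
  using assms by (auto simp: less_eq_vec_def gamma_triple_nth split: if_splits)

text \<open>Equal neighbours cancel because each map is an involution. Orbits can therefore be
  described by arbitrary words, which makes closure, symmetry and transitivity immediate.\<close>

lemma foldr_in_orbit_of:
  assumes "\<And>k x. g k (g k x) = x"
  shows "foldr g ks s \<in> orbit_of g s"
proof (induction ks)
  case Nil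
  show ?case by (auto simp: orbit_of_def intro!: exI[of _ "[]"])
next
  case (Cons k ks)
  then obtain js where js: "foldr g ks s = foldr g js s" "distinct_adj js"
    by (auto simp: orbit_of_def)
  show ?case
  proof (cases "js \<noteq> [] \<and> hd js = k")
    case True
    then obtain js' where "js = k # js'" by (cases js) auto
    then show ?thesis
      using js assms by (auto simp: orbit_of_def distinct_adj_Cons)
  next
    case False
    then have "distinct_adj (k # js)"
      using js by (auto simp: distinct_adj_Cons)
    then show ?thesis
      using js(1) by (auto simp: orbit_of_def intro!: exI[of _ "k # js"])
  qed
qed

lemma orbit_of_eq_range:
  assumes "\<And>k x. g k (g k x) = x"
  shows "orbit_of g s = range (\<lambda>ks. foldr g ks s)"
  using foldr_in_orbit_of[of g, OF assms] by (auto simp: orbit_of_def)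

lemmas Gamma_triple_eq = orbit_of_eq_range[of gamma_triple, OF gamma_triple_invol]
lemmas Gamma_array_eq = orbit_of_eq_range[of gamma_array, OF gamma_array_invol]

lemma Gamma_triple_self: "S \<in> Gamma_triple S"
  using foldr_in_orbit_of[of gamma_triple "[]" S, OF gamma_triple_invol] by simp

lemma Gamma_triple_closed:
  assumes "T \<in> Gamma_triple S"
  shows "gamma_triple k T \<in> Gamma_triple S"
proof -
  obtain ks where "T = foldr gamma_triple ks S"
    using assms unfolding Gamma_triple_eq by blast
  then have "gamma_triple k T = foldr gamma_triple (k # ks) S" by simp
  then show ?thesis unfolding Gamma_triple_eq by blast
qed

lemma foldr_gamma_triple_rev: "foldr gamma_triple (rev ks) (foldr gamma_triple ks S) = S"
  by (induction ks) (simp_all add: gamma_triple_invol)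

lemma Gamma_triple_sym:
  assumes "T \<in> Gamma_triple S"
  shows "S \<in> Gamma_triple T"
proof -
  obtain ks where "T = foldr gamma_triple ks S"
    using assms unfolding Gamma_triple_eq by blast
  then have "S = foldr gamma_triple (rev ks) T" by (simp only: foldr_gamma_triple_rev)
  then show ?thesis unfolding Gamma_triple_eq by blast
qed

lemma Gamma_triple_subset:
  assumes "T \<in> Gamma_triple S"
  shows "Gamma_triple T \<subseteq> Gamma_triple S"
proof
  fix U assume "U \<in> Gamma_triple T"
  then obtain ks ks' where "T = foldr gamma_triple ks S" "U = foldr gamma_triple ks' T"
    using assms unfolding Gamma_triple_eq by blast
  then have "U = foldr gamma_triple (ks' @ ks) S" by simp
  then show "U \<in> Gamma_triple S" unfolding Gamma_triple_eq by blast
qed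

lemma Gamma_triple_cong: "T \<in> Gamma_triple S \<Longrightarrow> Gamma_triple T = Gamma_triple S"
  by (rule subset_antisym[OF Gamma_triple_subset Gamma_triple_subset[OF Gamma_triple_sym]])

lemma cluster_positive_orbit:
  assumes "cluster_positive_triple S" "T \<in> Gamma_triple S"
  shows "cluster_positive_triple T"
  using assms by (simp add: cluster_positive_triple_def Gamma_triple_cong[OF assms(2)])

subsection \<open>Cluster-positive triples\<close>

definition triple_C :: "real ^ 3 \<Rightarrow> real" where
  "triple_C S = (S $ 1)\<^sup>2 + (S $ 2)\<^sup>2 + (S $ 3)\<^sup>2 - S $ 1 * S $ 2 * S $ 3"

lemma triple_C_shift:
  "triple_C S = (S $ k)\<^sup>2 + (S $ (k + 1))\<^sup>2 + (S $ (k + 2))\<^sup>2 - S $ k * S $ (k + 1) * S $ (k + 2)"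
  using exhaust_3[of k] by (elim disjE) (simp_all only: three_arith triple_C_def, simp_all)

text \<open>Vieta involution: C is a monic quadratic polynomial in the entry \<open>S $ k\<close>,
  and \<open>gamma_triple k\<close> replaces this entry by \<open>S $ (k + 1) * S $ (k + 2)\<close>
  minus itself, which takes the same value of C.\<close>

lemma triple_C_gamma: "triple_C (gamma_triple k S) = triple_C S"
  by (simp add: triple_C_shift[of _ k] gamma_triple_nth shift_neq power2_eq_square algebra_simps)

lemma triple_C_orbit: "T \<in> Gamma_triple S \<Longrightarrow> triple_C T = triple_C S"
proof -
  have "triple_C (foldr gamma_triple ks S) = triple_C S" for ks
    by (induction ks) (simp_all add: triple_C_gamma)
  then show "T \<in> Gamma_triple S \<Longrightarrow> triple_C T = triple_C S"
    by (auto simp: Gamma_triple_eq)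
qed

lemma linear_decrease_negative:
  fixes f :: "nat \<Rightarrow> real"
  assumes "0 < e" and step: "\<And>n. f (Suc n) \<le> f n - e"
  shows "\<exists>n. f n < 0"
proof -
  have le: "f n \<le> f 0 - real n * e" for n
  proof (induction n)
    case (Suc n)
    then show ?case using step[of n] by (simp add: algebra_simps)
  qed simp
  obtain n where "f 0 < real n * e"
    using reals_Archimedean3[OF \<open>0 < e\<close>] by blast
  then show ?thesis using le[of n] by (intro exI[of _ n]) linarith
qed

lemma positive_recurrence_coeff_ge_2:
  fixes u :: "nat \<Rightarrow> real"
  assumes pos: "\<And>n. 0 < u n"
    and rec: "\<And>n. u (Suc (Suc n)) = r * u (Suc n) - u n"
  shows "2 \<le> r"
proof (rule ccontr)
  assume "\<not> 2 \<le> r"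
  then have r: "0 < 2 - r" by simp
  \<comment> \<open>\<open>u\<close> is concave, so one negative increment would drive it below \<open>0\<close>; if all increments are
      nonnegative, they decrease by at least \<open>(2 - r) u 0\<close> each time.\<close>
  have step: "u (Suc (Suc n)) - u (Suc n) = u (Suc n) - u n - (2 - r) * u (Suc n)" for n
    using rec[of n] by (simp add: algebra_simps)
  have concave: "u (Suc (Suc n)) - u (Suc n) \<le> u (Suc n) - u n" for n
    using step[of n] mult_pos_pos[OF r pos[of "Suc n"]] by linarith
  have mono: "u n \<le> u (Suc n)" for n
  proof (rule ccontr)
    assume neg: "\<not> u n \<le> u (Suc n)"
    have "u (n + Suc m) \<le> u (n + m) - (u n - u (Suc n))" for m
    proof (induction m)
      case (Suc m)
      then show ?case using concave[of "n + m"] by simp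
    qed simp
    then have "\<exists>m. u (n + m) < 0"
      using neg by (intro linear_decrease_negative[where e = "u n - u (Suc n)"]) auto
    then show False using pos by (meson less_asym)
  qed
  have "u 0 \<le> u n" for n
    by (rule lift_Suc_mono_le[of u]) (use mono in auto)
  then have "(2 - r) * u 0 \<le> (2 - r) * u n" for n
    using r by (simp add: mult_left_mono)
  then have "u (Suc (Suc n)) - u (Suc n) \<le> u (Suc n) - u n - (2 - r) * u 0" for n
    using step[of n] by (metis diff_left_mono)
  then have "\<exists>n. u (Suc n) - u n < 0"
    using mult_pos_pos[OF r pos[of 0]] by (intro linear_decrease_negative) auto
  then show False using mono by (metis diff_ge_0_iff_ge not_less)
qed

lemma cluster_positive_ge_2:
  assumes S: "cluster_positive_triple S"
  shows "2 \<le> S $ k"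
proof -
  define c :: "nat \<Rightarrow> 3" where "c n = (if even n then k + 1 else k + 2)" for n
  define T where "T = rec_nat S (\<lambda>n. gamma_triple (c n))"
  have T: "T 0 = S" "T (Suc n) = gamma_triple (c n) (T n)" for n
    by (simp_all add: T_def)
  have orb: "T n \<in> Gamma_triple S" for n
    by (induction n) (simp_all add: T Gamma_triple_self Gamma_triple_closed)
  have Tk: "T n $ k = S $ k" for n
    by (induction n) (simp_all add: T gamma_triple_nth c_def shift_neq)
  \<comment> \<open>\<open>u n\<close> is the entry that step \<open>n\<close> is about to replace.
    Step \<open>n\<close> leaves the other moving entry alone, so that one is already
    \<open>u (Suc n)\<close>, and the replaced entry becomes \<open>u (Suc (Suc n))\<close>.\<close>
  define u where "u n = T n $ c n" for n
  have "0 < u n" for n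
    using S orb[of n] by (auto simp: cluster_positive_triple_def pos_triple_def u_def)
  moreover have "u (Suc (Suc n)) = S $ k * u (Suc n) - u n" for n
    using Tk[of "Suc n"] Tk[of n]
    by (auto simp: u_def T(2) gamma_triple_nth c_def shift_neq shift_shift)
  ultimately show ?thesis
    by (rule positive_recurrence_coeff_ge_2)
qed

section \<open>Decreasing directions and uniqueness of (M1)\<close>

lemma le_gamma_strict_other:
  assumes ge2: "\<And>i. 2 \<le> S $ i" and dec: "\<not> S \<le> gamma_triple k S" and "j \<noteq> k"
  shows "S \<le> gamma_triple j S" "gamma_triple j S \<noteq> S"
proof -
  \<comment> \<open>Multiplying \<open>q * r < 2 * p\<close> by \<open>r\<close> and using
    \<open>r * r >= 4\<close> gives \<open>4 * q <= q * r * r < 2 * p * r\<close>.\<close>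
  have aux: "2 * q < p * r" if "q * r < 2 * p" "2 \<le> q" "2 \<le> r" for p q r :: real
  proof -
    have "2 * 2 \<le> r * r" using that by (intro mult_mono) auto
    then have "q * (2 * 2) \<le> q * (r * r)" using that by (intro mult_left_mono) auto
    also have "\<dots> = (q * r) * r" by simp
    also have "\<dots> < 2 * p * r" using that by (intro mult_strict_right_mono) auto
    finally show ?thesis by simp
  qed
  have lt: "S $ (k + 1) * S $ (k + 2) < 2 * S $ k"
    using dec by (simp add: le_gamma_triple_iff)
  have "j = k + 1 \<or> j = k + 2"
    using \<open>j \<noteq> k\<close> forall_3_shift[of "\<lambda>i. i = k \<or> i = k + 1 \<or> i = k + 2" k] by auto
  then have *: "2 * S $ j < S $ (j + 1) * S $ (j + 2)"
    using aux[OF lt ge2 ge2] aux[of "S $ (k + 2)" "S $ (k + 1)" "S $ k"] lt ge2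
    by (auto simp: shift_shift mult.commute)
  then show "S \<le> gamma_triple j S" by (simp add: le_gamma_triple_iff)
  show "gamma_triple j S \<noteq> S"
    using * by (auto simp: vec_eq_iff gamma_triple_nth dest: spec[of _ j])
qed

text \<open>At most one index decreases a triple with entries at least 2, so the number of
  non-decreasing indices is 3 or 2.\<close>

lemma M2_iff_not_M1:
  assumes "cluster_positive_triple S"
  shows "M2 S \<longleftrightarrow> \<not> M1 S"
proof -
  have pos: "pos_triple S" using assms by (simp add: cluster_positive_triple_def)
  show ?thesis
  proof (cases "M1 S")
    case True
    then have "{i. S \<le> gamma_triple i S} = UNIV" by (auto simp: M1_def)
    then show ?thesis using True by (simp add: M2_def)
  next
    case False
    then obtain k where k: "\<not> S \<le> gamma_triple k S" using pos by (auto simp: M1_def)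
    have "{i. S \<le> gamma_triple i S} = - {k}"
      using k le_gamma_strict_other(1)[OF cluster_positive_ge_2[OF assms] k] by auto
    then show ?thesis using False pos by (simp add: M2_def Compl_eq_Diff_UNIV card_Diff_singleton)
  qed
qed

text \<open>Away from \<open>T\<close>, the only decreasing direction of a reduced word is the one it came from.\<close>

lemma reduced_word_from_M1:
  assumes "cluster_positive_triple T" and M1: "M1 T" and "distinct_adj ks"
  defines "U \<equiv> foldr gamma_triple ks T"
  shows "U = T \<or> ks \<noteq> [] \<and> \<not> U \<le> gamma_triple (hd ks) U"
  using \<open>distinct_adj ks\<close> unfolding U_def
proof (induction ks)
  case (Cons k ks)
  let ?U = "foldr gamma_triple ks T"
  have "?U \<in> Gamma_triple T" by (simp add: Gamma_triple_eq)
  then have ge2: "2 \<le> ?U $ i" for i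
    using assms(1) cluster_positive_orbit cluster_positive_ge_2 by blast
  have "?U \<le> gamma_triple k ?U \<and> (gamma_triple k ?U \<noteq> ?U \<or> ?U = T)"
  proof (cases "?U = T")
    case True
    then show ?thesis using M1 by (simp add: M1_def)
  next
    case False
    then have "ks \<noteq> []" and dec: "\<not> ?U \<le> gamma_triple (hd ks) ?U"
      using Cons by (auto simp: distinct_adj_Cons)
    then have "k \<noteq> hd ks" using Cons.prems by (cases ks) auto
    then show ?thesis using le_gamma_strict_other[OF ge2 dec] by blast
  qed
  \<comment> \<open>Applying \<open>k\<close> again leads back to \<open>?U\<close>, which is a
    decrease when the step just made was a strict increase. A map that fixes \<open>T\<close> leaves
    the word at \<open>T\<close>, the first alternative.\<close>
  then show ?case by (auto simp: gamma_triple_invol dest: antisym)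
qed simp

lemma M1_unique:
  assumes "cluster_positive_triple T" "M1 T" "M1 U" "U \<in> Gamma_triple T"
  shows "U = T"
proof -
  obtain ks where U: "U = foldr gamma_triple ks T" and ks: "distinct_adj ks"
    using assms(4) by (auto simp: orbit_of_def)
  \<comment> \<open>For \<open>ks = []\<close> the index \<open>hd ks\<close> is unspecified, but
    (M1) covers every index.\<close>
  have "U \<le> gamma_triple (hd ks) U"
    using assms(3) by (simp add: M1_def)
  then show ?thesis
    using reduced_word_from_M1[OF assms(1,2) ks] by (simp flip: U)
qed

lemma cond_A_triple_iff:
  assumes "cluster_positive_triple S"
  shows "cond_A_triple S \<longleftrightarrow> (\<exists>T\<in>Gamma_triple S. M1 T)"
proof -
  have "T = U" if "T \<in> Gamma_triple S" "M1 T" "U \<in> Gamma_triple S" "M1 U" for T U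
    using that by (intro M1_unique cluster_positive_orbit[OF assms]) (simp_all add: Gamma_triple_cong[of U S])
  then show ?thesis
    using assms by (auto simp: cond_A_triple_def)
qed

lemma cond_B_triple_iff:
  assumes "cluster_positive_triple S"
  shows "cond_B_triple S \<longleftrightarrow> (\<forall>T\<in>Gamma_triple S. \<not> M1 T)"
  using assms M2_iff_not_M1 cluster_positive_orbit unfolding cond_B_triple_def by blast

subsection \<open>Attaining (M1)\<close>

text \<open>Among triples with all entries at least 2, these are exactly the ones where (M1) and C =
  4 occur together. The index \<open>k\<close> replaces a distinction of three shapes.\<close>

definition degenerate :: "real ^ 3 \<Rightarrow> bool" where
  "degenerate S \<longleftrightarrow> (\<exists>k. S $ k = 2 \<and> S $ (k + 1) = S $ (k + 2))"

lemma degenerate_M1: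
  assumes "degenerate S" and ge2: "\<And>i. 2 \<le> S $ i"
  shows "M1 S"
proof -
  obtain k where k: "S $ k = 2" "S $ (k + 1) = S $ (k + 2)"
    using assms(1) by (auto simp: degenerate_def)
  \<comment> \<open>This is the inequality needed at \<open>k\<close>; at the other two indices both
    sides are equal.\<close>
  have "2 * 2 \<le> S $ (k + 2) * S $ (k + 2)"
    using ge2 by (intro mult_mono) (auto intro: order_trans[OF _ ge2])
  then have "\<forall>i. S \<le> gamma_triple i S"
    using k by (simp add: forall_3_shift[of _ k] le_gamma_triple_iff shift_shift)
  moreover have "0 < S $ i" for i
    using ge2[of i] by linarith
  ultimately show ?thesis by (simp add: M1_def pos_triple_def)
qed

text \<open>With one entry equal to 2, C is 4 plus the square of the difference of the other two
  entries.\<close>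

lemma degenerate_if_C_4:
  assumes "triple_C S = 4" "S $ k = 2"
  shows "degenerate S"
proof -
  have "(S $ (k + 1) - S $ (k + 2))\<^sup>2 = 0"
    using assms by (simp add: triple_C_shift[of S k] power2_eq_square algebra_simps)
  then show ?thesis using assms(2) by (auto simp: degenerate_def)
qed

text \<open>The right-hand side is \<open>3 * p^2 - p^3\<close>, the value of C at
  \<open>(p, p, p)\<close>, written so that its distance from 4 is visible. The assumptions give
  \<open>q + r <= 2 * r <= p * q\<close>, which controls the passage from \<open>r\<close> to
  \<open>q\<close>.\<close>

lemma M1_minimal_entry_bound:
  fixes p q r :: real
  assumes "2 \<le> p" "p \<le> q" "q \<le> r" "2 * r \<le> p * q"
  shows "p\<^sup>2 + q\<^sup>2 + r\<^sup>2 - p * q * r \<le> 4 - (p - 2)\<^sup>2 * (p + 1)"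
proof -
  \<comment> \<open>Lower \<open>r\<close> to \<open>q\<close>, then \<open>q\<close> to \<open>p\<close>; neither decreases the left-hand side.\<close>
  have "(r - q) * (q + r - p * q) \<le> 0"
    using assms by (intro mult_nonneg_nonpos) auto
  moreover have "(p - 2) * p\<^sup>2 \<le> (p - 2) * q\<^sup>2"
    using assms by (intro mult_left_mono power_mono) auto
  ultimately show ?thesis
    by (simp add: power2_eq_square algebra_simps)
qed

text \<open>The bound is applied with \<open>k\<close> at a smallest entry and the other two entries
  sorted. Equality forces that smallest entry to be 2.\<close>

lemma M1_triple_C:
  assumes "M1 S" and ge2: "\<And>i. 2 \<le> S $ i"
  shows "triple_C S \<le> 4" "triple_C S = 4 \<Longrightarrow> degenerate S"
proof -
  obtain k where min: "S $ k \<le> S $ i" for i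
    using ex_min_if_finite[of "range (($) S)"] by (auto simp: not_less)
  have le: "2 * S $ i \<le> S $ (i + 1) * S $ (i + 2)" for i
    using assms(1) by (simp add: M1_def le_gamma_triple_iff)
  have le': "2 * S $ (k + 1) \<le> S $ k * S $ (k + 2)" "2 * S $ (k + 2) \<le> S $ k * S $ (k + 1)"
    using le[of "k + 1"] le[of "k + 2"] by (simp_all add: shift_shift mult.commute)
  have bound: "triple_C S \<le> 4 - (S $ k - 2)\<^sup>2 * (S $ k + 1)"
  proof (cases "S $ (k + 1) \<le> S $ (k + 2)")
    case True
    then show ?thesis
      using M1_minimal_entry_bound[OF ge2 min True le'(2)]
      by (simp add: triple_C_shift[of S k])
  next
    case False
    then show ?thesis
      using M1_minimal_entry_bound[OF ge2 min _ le'(1)]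
      by (simp add: triple_C_shift[of S k] algebra_simps)
  qed
  have nonneg: "0 \<le> (S $ k - 2)\<^sup>2 * (S $ k + 1)"
    using ge2[of k] by simp
  show "triple_C S \<le> 4" using bound nonneg by linarith
  assume "triple_C S = 4"
  then have "(S $ k - 2)\<^sup>2 * (S $ k + 1) = 0"
    using bound nonneg by linarith
  then have "S $ k = 2" using ge2[of k] by auto
  then show "degenerate S" using \<open>triple_C S = 4\<close> by (rule degenerate_if_C_4[rotated])
qed

section \<open>Orbits of the permutations of \<open>(2, p, p)\<close>\<close>

lemma degenerate_iff:
  "degenerate S \<longleftrightarrow>
    (\<exists>p. S = vector [p, p, 2] \<or> S = vector [p, 2, p] \<or> S = vector [2, p, p])"
proof
  assume "degenerate S"
  then obtain k where "S $ k = 2" "S $ (k + 1) = S $ (k + 2)"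
    by (auto simp: degenerate_def)
  then show "\<exists>p. S = vector [p, p, 2] \<or> S = vector [p, 2, p] \<or> S = vector [2, p, p]"
    using exhaust_3[of k]
    by (intro exI[of _ "S $ (k + 1)"], elim disjE)
      (simp_all only: three_arith vec_eq_iff forall_3 vector_3, auto)
next
  have "vector [p, p, 2] $ (3::3) = 2 \<and> vector [p, p, 2] $ ((3::3) + 1) = vector [p, p, 2] $ ((3::3) + 2)"
    "vector [p, 2, p] $ (2::3) = 2 \<and> vector [p, 2, p] $ ((2::3) + 1) = vector [p, 2, p] $ ((2::3) + 2)"
    "vector [2, p, p] $ (1::3) = 2 \<and> vector [2, p, p] $ ((1::3) + 1) = vector [2, p, p] $ ((1::3) + 2)"
    for p :: real
    by (simp_all only: three_arith vector_3)
  then show "\<exists>p. S = vector [p, p, 2] \<or> S = vector [p, 2, p] \<or> S = vector [2, p, p] \<Longrightarrow> degenerate S"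
    unfolding degenerate_def by metis
qed

lemma degenerate_orbit_iff:
  assumes S: "cluster_positive_triple S"
  shows "(\<exists>p\<ge>2. S \<in> Gamma_triple (vector [p, p, 2]) \<or> S \<in> Gamma_triple (vector [p, 2, p]) \<or>
      S \<in> Gamma_triple (vector [2, p, p])) \<longleftrightarrow> (\<exists>T\<in>Gamma_triple S. degenerate T)"
    (is "?lhs \<longleftrightarrow> ?rhs")
proof
  assume ?lhs
  then obtain p where "vector [p, p, 2] \<in> Gamma_triple S \<or> vector [p, 2, p] \<in> Gamma_triple S \<or>
      vector [2, p, p] \<in> Gamma_triple S"
    using Gamma_triple_sym by meson
  then show ?rhs using degenerate_iff by blast
next
  assume ?rhs
  then obtain T p where T: "T \<in> Gamma_triple S"
    "T = vector [p, p, 2] \<or> T = vector [p, 2, p] \<or> T = vector [2, p, p]"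
    using degenerate_iff by blast
  have "2 \<le> T $ i" for i
    using T(1) S cluster_positive_orbit cluster_positive_ge_2 by blast
  \<comment> \<open>In each of the three shapes \<open>p\<close> occupies the first or the second
    place.\<close>
  from this[of 1] this[of 2] have "2 \<le> p" using T(2) by auto
  then show ?lhs using T(2) Gamma_triple_sym[OF T(1)] by blast
qed

subsection \<open>Infinite descent\<close>

lemma descending_triples_limit:
  fixes T :: "nat \<Rightarrow> real ^ 3" and t :: "nat \<Rightarrow> 3"
  assumes S: "cluster_positive_triple (T 0)"
    and step: "\<And>n. T (Suc n) = gamma_triple (t n) (T n)"
    and dec: "\<And>n. \<not> T n \<le> T (Suc n)"
    and no_M1: "\<And>U. U \<in> Gamma_triple (T 0) \<Longrightarrow> \<not> M1 U"
  shows "T \<longlonglongrightarrow> (\<chi> i. 2)" "triple_C (T 0) = 4"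
proof -
  have orb: "T n \<in> Gamma_triple (T 0)" for n
    by (induction n) (simp_all add: step Gamma_triple_self Gamma_triple_closed)
  have ge2: "2 \<le> T n $ k" for n k
    using orb S cluster_positive_orbit cluster_positive_ge_2 by blast
  have "T (Suc n) \<le> T n" for n
    using dec[of n] gamma_triple_le by (simp add: step)
  then have "decseq (\<lambda>n. T n $ k)" for k
    by (intro decseq_SucI) (simp add: less_eq_vec_def)
  then have "convergent (\<lambda>n. T n $ k)" for k
    using ge2 by (metis decseq_convergent convergentI)
  then obtain l where l: "(\<lambda>n. T n $ k) \<longlonglongrightarrow> l k" for k
    unfolding convergent_def by metis
  have l_ge2: "2 \<le> l k" for k
    using l[of k] ge2 by (intro LIMSEQ_le_const) auto
  have C_lim: "(l k)\<^sup>2 + (l (k + 1))\<^sup>2 + (l (k + 2))\<^sup>2 - l k * l (k + 1) * l (k + 2) = triple_C (T 0)"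
    for k
  proof -
    have "(\<lambda>n. triple_C (T n)) \<longlonglongrightarrow>
        (l k)\<^sup>2 + (l (k + 1))\<^sup>2 + (l (k + 2))\<^sup>2 - l k * l (k + 1) * l (k + 2)"
      unfolding triple_C_shift[of _ k] by (intro tendsto_intros l)
    moreover have "(\<lambda>n. triple_C (T n)) = (\<lambda>n. triple_C (T 0))"
      using triple_C_orbit[OF orb] by auto
    ultimately show ?thesis by (simp add: LIMSEQ_const_iff)
  qed
  have fixed: "2 * l k = l (k + 1) * l (k + 2)" if inf: "\<exists>\<^sub>F n in sequentially. t n = k" for k
  proof (rule ccontr)
    \<comment> \<open>\<open>?d n\<close> vanishes whenever \<open>t n = k\<close>, so a nonzero
      limit would exclude the label \<open>k\<close> from some point on.\<close>
    let ?d = "\<lambda>n. T n $ (k + 1) * T n $ (k + 2) - T n $ k - T (Suc n) $ k"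
    assume "2 * l k \<noteq> l (k + 1) * l (k + 2)"
    then have "l (k + 1) * l (k + 2) - l k - l k \<noteq> 0" by simp
    moreover have "?d \<longlonglongrightarrow> l (k + 1) * l (k + 2) - l k - l k"
      by (intro tendsto_intros l LIMSEQ_Suc)
    ultimately have "\<forall>\<^sub>F n in sequentially. ?d n \<noteq> 0"
      by (intro tendsto_imp_eventually_ne)
    then have "\<forall>\<^sub>F n in sequentially. t n \<noteq> k"
      by eventually_elim (auto simp: step gamma_triple_nth)
    then show False using inf by (simp add: frequently_def)
  qed
  \<comment> \<open>Repeating an index undoes the previous decrease and so would be an
    increase.\<close>
  have t_adj: "t (Suc n) \<noteq> t n" for n
  proof
    assume "t (Suc n) = t n"
    then have "T (Suc (Suc n)) = T n" by (simp add: step gamma_triple_invol)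
    then show False using dec[of "Suc n"] \<open>\<And>n. T (Suc n) \<le> T n\<close> by metis
  qed
  \<comment> \<open>Otherwise the labels would eventually be constant, contrary to
    \<open>t_adj\<close>.\<close>
  have two_inf: "\<not> ((\<forall>\<^sub>F n in sequentially. t n \<noteq> k + 1) \<and> (\<forall>\<^sub>F n in sequentially. t n \<noteq> k + 2))"
    for k
  proof
    assume "(\<forall>\<^sub>F n in sequentially. t n \<noteq> k + 1) \<and> (\<forall>\<^sub>F n in sequentially. t n \<noteq> k + 2)"
    then have "\<forall>\<^sub>F n in sequentially. t n \<noteq> k + 1 \<and> t n \<noteq> k + 2"
      by (simp add: eventually_conj)
    then have "\<forall>\<^sub>F n in sequentially. t n = k"
      by eventually_elim (use forall_3_shift[of "\<lambda>i. i = k \<or> i = k + 1 \<or> i = k + 2" k] in auto)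
    moreover from this have "\<forall>\<^sub>F n in sequentially. t (Suc n) = k"
      by (simp add: eventually_sequentially_Suc[of "\<lambda>n. t n = k"])
    ultimately have "\<forall>\<^sub>F n in sequentially. False"
      by eventually_elim (use t_adj in auto)
    then show False by simp
  qed
  have two_fixed: "l (k + 1) = l (k + 2)" "l k = 2"
    if "\<exists>\<^sub>F n in sequentially. t n = k + 1" "\<exists>\<^sub>F n in sequentially. t n = k + 2" for k
  proof -
    have eqs: "2 * l (k + 1) = l (k + 2) * l k" "2 * l (k + 2) = l k * l (k + 1)"
      using fixed[OF that(1)] fixed[OF that(2)] by (simp_all add: shift_shift)
    \<comment> \<open>Difference of the two equations; the first factor is positive.\<close>
    then have "(l k + 2) * (l (k + 1) - l (k + 2)) = 0"
      by (simp add: algebra_simps)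
    then show eq: "l (k + 1) = l (k + 2)"
      using l_ge2[of k] by simp
    then show "l k = 2"
      using eqs(1) l_ge2[of "k + 2"] by simp
  qed
  have inf: "\<exists>\<^sub>F n in sequentially. t n = k" for k
  proof (rule ccontr)
    assume "\<not> (\<exists>\<^sub>F n in sequentially. t n = k)"
    then have fin: "\<forall>\<^sub>F n in sequentially. t n \<noteq> k" by (simp add: frequently_def)
    then have "\<exists>\<^sub>F n in sequentially. t n = k + 1" "\<exists>\<^sub>F n in sequentially. t n = k + 2"
      using two_inf[of "k + 1"] two_inf[of "k + 2"] by (simp_all add: frequently_def shift_shift)
    then have eq: "l (k + 1) = l (k + 2)" and "l k = 2"
      using two_fixed[of k] by simp_all
    then have C: "triple_C (T 0) = 4"
      using C_lim[of k] eq by (simp add: power2_eq_square)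
    have "\<forall>\<^sub>F n in sequentially. T (Suc n) $ k = T n $ k"
      using fin by eventually_elim (simp add: step gamma_triple_nth)
    \<comment> \<open>Entry \<open>k\<close> is frozen from \<open>n0\<close> on, so its limit 2 is
      already attained at \<open>n0\<close>. Since C = 4, the triple there is degenerate and
      satisfies (M1), which is excluded.\<close>
    then obtain n0 where n0: "\<And>n. n \<ge> n0 \<Longrightarrow> T (Suc n) $ k = T n $ k"
      by (auto simp: eventually_sequentially)
    have "T (m + n0) $ k = T n0 $ k" for m
      by (induction m) (simp_all add: n0)
    then have "l k = T n0 $ k"
      using LIMSEQ_ignore_initial_segment[OF l[of k], of n0] by (simp add: LIMSEQ_const_iff)
    then have "degenerate (T n0)"
      using \<open>l k = 2\<close> C triple_C_orbit[OF orb, of n0] by (intro degenerate_if_C_4) auto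
    then show False
      using degenerate_M1[OF _ ge2] no_M1[OF orb] by blast
  qed
  have l2: "l k = 2" for k
    using two_fixed(2)[OF inf inf] .
  show "T \<longlonglongrightarrow> (\<chi> i. 2)"
    using l by (intro vec_tendstoI) (simp add: l2)
  show "triple_C (T 0) = 4"
    using C_lim[of 1] by (simp add: l2)
qed

lemma descending_triples_exist:
  assumes "cluster_positive_triple S" and no_M1: "\<And>U. U \<in> Gamma_triple S \<Longrightarrow> \<not> M1 U"
  shows "\<exists>T t. T 0 = S \<and> (\<forall>n. T (Suc n) = gamma_triple (t n) (T n) \<and> \<not> T n \<le> T (Suc n))"
proof -
  \<comment> \<open>Only values on the orbit of \<open>S\<close> matter, and there the failure of
    (M1) provides a decreasing index.\<close>
  define d where "d U = (SOME k. \<not> U \<le> gamma_triple k U)" for U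
  define T where "T = rec_nat S (\<lambda>_ U. gamma_triple (d U) U)"
  have T: "T 0 = S" "T (Suc n) = gamma_triple (d (T n)) (T n)" for n
    by (simp_all add: T_def)
  have orb: "T n \<in> Gamma_triple S" for n
    by (induction n) (simp_all add: T Gamma_triple_self Gamma_triple_closed)
  have "\<not> T n \<le> gamma_triple (d (T n)) (T n)" for n
  proof -
    have "pos_triple (T n)"
      using assms(1) orb by (auto simp: cluster_positive_triple_def)
    then have "\<exists>k. \<not> T n \<le> gamma_triple k (T n)"
      using no_M1[OF orb, of n] by (auto simp: M1_def)
    then show ?thesis unfolding d_def by (rule someI_ex)
  qed
  then show ?thesis using T by (intro exI[of _ T] exI[of _ "\<lambda>n. d (T n)"]) simp
qed

text \<open>Both equivalences follow from three implications: without (M1) the descent gives C = 4;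
  (M1) gives C at most 4, with equality only for degenerate triples; and degenerate triples satisfy
  (M1).\<close>

lemma exists_M1_iff:
  assumes S: "cluster_positive_triple S"
  shows "(\<exists>U\<in>Gamma_triple S. M1 U) \<longleftrightarrow> triple_C S < 4 \<or> (\<exists>U\<in>Gamma_triple S. degenerate U)"
    and "\<not> (\<exists>U\<in>Gamma_triple S. M1 U) \<longleftrightarrow> triple_C S = 4 \<and> \<not> (\<exists>U\<in>Gamma_triple S. degenerate U)"
proof -
  have ge2: "2 \<le> U $ i" if "U \<in> Gamma_triple S" for U i
    using that S cluster_positive_orbit cluster_positive_ge_2 by blast
  have "triple_C S = 4" if "\<not> (\<exists>U\<in>Gamma_triple S. M1 U)"
    using descending_triples_exist[OF S] descending_triples_limit(2) that S by metis
  moreover have "triple_C S \<le> 4 \<and> (triple_C S = 4 \<longrightarrow> degenerate U)"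
    if "U \<in> Gamma_triple S" "M1 U" for U
    using M1_triple_C[OF that(2) ge2[OF that(1)]] triple_C_orbit[OF that(1)] by simp
  moreover have "M1 U" if "U \<in> Gamma_triple S" "degenerate U" for U
    using degenerate_M1 ge2 that by blast
  ultimately show "(\<exists>U\<in>Gamma_triple S. M1 U) \<longleftrightarrow> triple_C S < 4 \<or> (\<exists>U\<in>Gamma_triple S. degenerate U)"
    "\<not> (\<exists>U\<in>Gamma_triple S. M1 U) \<longleftrightarrow> triple_C S = 4 \<and> \<not> (\<exists>U\<in>Gamma_triple S. degenerate U)"
    by (metis less_le less_irrefl)+
qed

subsection \<open>From arrays to triples\<close>

text \<open>\<open>W\<close> is meant to hold the constant ratios of an array to its
  \<open>Sk\<close>, so that \<open>S\<close> alone carries the dynamics.\<close>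

definition column_scale :: "real ^ 3 ^ 2 \<Rightarrow> real ^ 3 \<Rightarrow> real ^ 3 ^ 2" where
  "column_scale W S = (\<chi> i j. W $ i $ j * S $ j)"

lemma column_scale_nth [simp]: "column_scale W S $ i $ j = W $ i $ j * S $ j"
  by (simp add: column_scale_def)

text \<open>In the opposite row, the weights at columns \<open>k + 1\<close> and
  \<open>k + 2\<close> multiply to the inverse of the weight at \<open>k\<close>, by the row
  condition. By the column condition this inverse is \<open>W $ i $ k\<close>, so both terms of the
  new entry carry the same factor.\<close>

lemma gamma_array_column_scale:
  assumes W: "\<And>j. W $ 1 $ j * W $ 2 $ j = 1" and one: "\<And>i. W $ i $ 1 * W $ i $ 2 * W $ i $ 3 = 1"
  shows "gamma_array k (column_scale W S) = column_scale W (gamma_triple k S)"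
proof -
  have row: "W $ i $ k * (W $ i $ (k + 1) * W $ i $ (k + 2)) = 1" for i
    using one[of i] exhaust_3[of k] by (elim disjE) (simp_all only: three_arith mult_ac)
  have two: "(1::2) + 1 = 2" "(2::2) + 1 = 1" by simp_all
  have col: "W $ i $ k * W $ (i + 1) $ k = 1" for i
    using exhaust_2[of i]
  proof
    assume "i = 1"
    then show ?thesis using W[of k] by (simp only: two)
  next
    assume "i = 2"
    then show ?thesis using W[of k] by (simp only: two mult.commute[of "W $ 2 $ k"])
  qed
  have key: "W $ (i + 1) $ (k + 1) * W $ (i + 1) $ (k + 2) = W $ i $ k" for i
  proof -
    have "W $ (i + 1) $ (k + 1) * W $ (i + 1) $ (k + 2) =
        W $ i $ k * W $ (i + 1) $ k * (W $ (i + 1) $ (k + 1) * W $ (i + 1) $ (k + 2))"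
      by (simp only: col mult_1_left)
    also have "\<dots> = W $ i $ k"
      by (simp only: mult.assoc row mult_1_right)
    finally show ?thesis .
  qed
  have "W $ (i + 1) $ (k + 1) * S $ (k + 1) * (W $ (i + 1) $ (k + 2) * S $ (k + 2)) =
      W $ i $ k * (S $ (k + 1) * S $ (k + 2))" for i
    by (simp only: key[symmetric] mult_ac)
  then show ?thesis
    by (simp add: vec_eq_iff gamma_array_nth gamma_triple_nth right_diff_distrib)
qed

lemma foldr_gamma_array_column_scale:
  assumes "\<And>k S. gamma_array k (column_scale W S) = column_scale W (gamma_triple k S)"
  shows "foldr gamma_array ks (column_scale W S) = column_scale W (foldr gamma_triple ks S)"
  by (induction ks) (simp_all add: assms)

lemma column_scale_le_iff:
  assumes "\<And>i j. 0 < W $ i $ j"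
  shows "column_scale W S \<le> column_scale W T \<longleftrightarrow> S \<le> T"
  by (simp add: less_eq_vec_def assms)

lemma pos_array_column_scale_iff:
  assumes "\<And>i j. 0 < W $ i $ j"
  shows "pos_array (column_scale W S) \<longleftrightarrow> pos_triple S"
proof -
  have "0 < W $ i $ j * S $ j \<longleftrightarrow> 0 < S $ j" for i j
  proof
    assume "0 < W $ i $ j * S $ j"
    then show "0 < S $ j" by (rule zero_less_mult_pos[OF _ assms])
  qed (rule mult_pos_pos[OF assms])
  then show ?thesis
    by (simp add: pos_array_def pos_triple_def)
qed

lemma Mplus_Sk:
  assumes "M \<in> Mplus"
  shows "0 < Sk M $ j" "(Sk M $ j)\<^sup>2 = M $ 1 $ j * M $ 2 $ j"
    "Sk M $ 1 * Sk M $ 2 * Sk M $ 3 = M $ i $ 1 * M $ i $ 2 * M $ i $ 3"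
proof -
  have pos: "0 < M $ i $ j" for i j
    using assms by (simp add: Mplus_def)
  have eq: "M $ 1 $ 1 * M $ 1 $ 2 * M $ 1 $ 3 = M $ 2 $ 1 * M $ 2 $ 2 * M $ 2 $ 3"
    using assms by (simp add: Mplus_def)
  have Sk: "Sk M $ j = sqrt (M $ 1 $ j * M $ 2 $ j)" for j
    using exhaust_3[of j] by (auto simp: Sk_def)
  show "0 < Sk M $ j" "(Sk M $ j)\<^sup>2 = M $ 1 $ j * M $ 2 $ j" for j
    using pos by (simp_all add: Sk less_imp_le)
  let ?P = "M $ 1 $ 1 * M $ 1 $ 2 * M $ 1 $ 3"
  \<comment> \<open>Regrouping the factors under the root by rows leaves the product of the two row
    products, which agree in \<open>Mplus\<close>.\<close>
  have "Sk M $ 1 * Sk M $ 2 * Sk M $ 3 =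
      sqrt (?P * (M $ 2 $ 1 * M $ 2 $ 2 * M $ 2 $ 3))"
    by (simp add: Sk mult_ac flip: real_sqrt_mult)
  also have "\<dots> = ?P"
    using pos by (simp flip: eq add: less_imp_le)
  finally show "Sk M $ 1 * Sk M $ 2 * Sk M $ 3 = M $ i $ 1 * M $ i $ 2 * M $ i $ 3"
    using exhaust_2[of i] eq by auto
qed

lemma markov_C_eq_triple_C: "M \<in> Mplus \<Longrightarrow> markov_C M = triple_C (Sk M)"
  using Mplus_Sk(2)[of M] Mplus_Sk(3)[of M 1] by (simp add: markov_C_def triple_C_def)

text \<open>The ratios multiply to 1 in each column by the definition of \<open>Sk\<close>, and in
  each row because \<open>Sk M\<close> has the same product of entries as either row of
  \<open>M\<close>.\<close>

lemma Mplus_column_scale_Sk: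
  assumes "M \<in> Mplus"
  obtains W where "M = column_scale W (Sk M)" "\<And>i j. 0 < W $ i $ j"
    "\<And>k S. gamma_array k (column_scale W S) = column_scale W (gamma_triple k S)"
proof
  let ?W = "\<chi> i j. M $ i $ j / Sk M $ j"
  note pos = Mplus_Sk(1)[OF assms]
  have ne: "Sk M $ j \<noteq> 0" for j
    using pos[of j] by simp
  show "M = column_scale ?W (Sk M)"
    by (simp add: vec_eq_iff ne)
  show "0 < ?W $ i $ j" for i j
    using assms pos by (simp add: Mplus_def)
  show "gamma_array k (column_scale ?W S) = column_scale ?W (gamma_triple k S)" for k S
  proof (rule gamma_array_column_scale)
    show "?W $ 1 $ j * ?W $ 2 $ j = 1" for j
    proof -
      have "?W $ 1 $ j * ?W $ 2 $ j = M $ 1 $ j * M $ 2 $ j / (Sk M $ j)\<^sup>2"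
        by (simp add: power2_eq_square)
      also have "\<dots> = 1"
        unfolding Mplus_Sk(2)[OF assms, symmetric] using ne[of j] by simp
      finally show ?thesis .
    qed
    show "?W $ i $ 1 * ?W $ i $ 2 * ?W $ i $ 3 = 1" for i
      using ne by (simp flip: Mplus_Sk(3)[OF assms, of i])
  qed
qed

text \<open>Every word acts on \<open>M\<close> as on \<open>Sk M\<close> up to positive weights,
  and these do not affect positivity.\<close>

lemma cluster_positive_Sk:
  assumes "cluster_positive_array M"
  shows "cluster_positive_triple (Sk M)"
proof -
  have M: "M \<in> Mplus" using assms by (simp add: cluster_positive_array_def)
  obtain W where W: "M = column_scale W (Sk M)" "\<And>i j. 0 < W $ i $ j"
    "\<And>k S. gamma_array k (column_scale W S) = column_scale W (gamma_triple k S)"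
    using Mplus_column_scale_Sk[OF M] by blast
  have "pos_triple (foldr gamma_triple ks (Sk M))" for ks
  proof -
    have "pos_array (foldr gamma_array ks M)"
      using assms unfolding cluster_positive_array_def Gamma_array_eq by blast
    then have "pos_array (column_scale W (foldr gamma_triple ks (Sk M)))"
      by (metis W(1) foldr_gamma_array_column_scale[of W, OF W(3)])
    then show ?thesis by (simp add: pos_array_column_scale_iff[OF W(2)])
  qed
  then show ?thesis
    using Mplus_Sk(1)[OF M]
    by (auto simp: cluster_positive_triple_def Gamma_triple_eq pos_triple_def)
qed

section \<open>Descending paths of arrays\<close>

lemma descending_path_limit:
  assumes M: "cluster_positive_array M" and no_M1: "\<And>U. U \<in> Gamma_triple (Sk M) \<Longrightarrow> \<not> M1 U"
  shows "\<exists>N t. descending_path M N t \<and>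
    (\<forall>N' t'. descending_path M N' t' \<longrightarrow> N' = N \<and> t' = t) \<and>
    (\<exists>L. N \<longlonglongrightarrow> L \<and> (\<forall>k. gamma_array k L = L))"
proof -
  have S: "cluster_positive_triple (Sk M)" using cluster_positive_Sk[OF M] .
  obtain T t where T: "T 0 = Sk M" "\<And>n. T (Suc n) = gamma_triple (t n) (T n)" "\<And>n. \<not> T n \<le> T (Suc n)"
    using descending_triples_exist[OF S no_M1] by blast
  have "M \<in> Mplus" using M by (simp add: cluster_positive_array_def)
  then obtain W where W: "M = column_scale W (Sk M)" "\<And>i j. 0 < W $ i $ j"
    "\<And>k S. gamma_array k (column_scale W S) = column_scale W (gamma_triple k S)"
    using Mplus_column_scale_Sk by blast
  define N where "N n = column_scale W (T n)" for n
  have ge2: "2 \<le> T n $ i" for n i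
  proof -
    have "T n \<in> Gamma_triple (Sk M)"
      by (induction n) (simp_all add: T Gamma_triple_self Gamma_triple_closed)
    then show ?thesis
      using S cluster_positive_orbit cluster_positive_ge_2 by blast
  qed
  have "descending_path M N t"
    using W(1) T(3) by (simp add: descending_path_def N_def T(1,2) W(3) column_scale_le_iff[OF W(2)])
  moreover have "\<forall>N' t'. descending_path M N' t' \<longrightarrow> N' = N \<and> t' = t"
  proof (intro allI impI)
    fix N' t' assume path: "descending_path M N' t'"
    \<comment> \<open>With all entries at least 2 there is at most one decreasing index, so the
      label is forced.\<close>
    have label: "t' n = t n" if eq: "N' n = N n" for n
    proof -
      have "\<not> T n \<le> gamma_triple (t' n) (T n)"
      proof -
        have "N' (Suc n) = gamma_array (t' n) (N' n)" "\<not> N' n \<le> N' (Suc n)"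
          using path unfolding descending_path_def by blast+
        then show ?thesis
          by (simp add: eq N_def W(3) column_scale_le_iff[OF W(2)])
      qed
      moreover have "\<not> T n \<le> gamma_triple (t n) (T n)"
        using T(2,3)[of n] by simp
      ultimately show ?thesis
        by (metis le_gamma_strict_other(1)[OF ge2])
    qed
    have "N' n = N n" for n
    proof (induction n)
      case 0
      then show ?case using path W(1) by (simp add: descending_path_def N_def T(1))
    next
      case (Suc n)
      then show ?case
        using path label[OF Suc] by (simp add: descending_path_def N_def T(2) W(3))
    qed
    then show "N' = N \<and> t' = t" using label by auto
  qed
  moreover have "N \<longlonglongrightarrow> column_scale W (\<chi> i. 2)"
  proof -
    have "T \<longlonglongrightarrow> (\<chi> i. 2)"
      using descending_triples_limit(1)[of T t] S no_M1 T by simp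
    then have "(\<lambda>n. T n $ j) \<longlonglongrightarrow> 2" for j
      using tendsto_vec_nth[of T "\<chi> i. 2" sequentially j] by simp
    then show ?thesis
      unfolding N_def by (intro vec_tendstoI) (auto intro!: tendsto_intros)
  qed
  moreover have "\<forall>k. gamma_array k (column_scale W (\<chi> i. 2)) = column_scale W (\<chi> i. 2)"
  proof
    have "gamma_triple k (\<chi> i. 2) = (\<chi> i. 2)" for k
      by (simp add: vec_eq_iff gamma_triple_nth)
    then show "gamma_array k (column_scale W (\<chi> i. 2)) = column_scale W (\<chi> i. 2)" for k
      by (simp add: W(3))
  qed
  ultimately show ?thesis
    by (intro exI[of _ N] exI[of _ t] conjI exI[of _ "column_scale W (\<chi> i. 2)"])
qed

theorem theorem10p3:
  fixes M :: "real ^ 3 ^ 2"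
  assumes "M \<in> Mplus" and "cluster_positive_array M"
  shows "(cond_A M \<longleftrightarrow>
            markov_C M < 4 \<or>
            (\<exists>p\<ge>2. Sk M \<in> Gamma_triple (vector [p, p, 2]) \<or>
                   Sk M \<in> Gamma_triple (vector [p, 2, p]) \<or>
                   Sk M \<in> Gamma_triple (vector [2, p, p])))
       \<and> (cond_B M \<longleftrightarrow>
            markov_C M = 4 \<and>
            (\<forall>p\<ge>2. Sk M \<notin> Gamma_triple (vector [p, p, 2]) \<and>
                   Sk M \<notin> Gamma_triple (vector [p, 2, p]) \<and>
                   Sk M \<notin> Gamma_triple (vector [2, p, p])))
       \<and> (cond_B M \<longrightarrow>
            (\<exists>N t. descending_path M N t \<and>
                   (\<forall>N' t'. descending_path M N' t' \<longrightarrow> N' = N \<and> t' = t) \<and>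
                   (\<exists>L. N \<longlonglongrightarrow> L \<and> (\<forall>k. gamma_array k L = L))))"
proof -
  have S: "cluster_positive_triple (Sk M)"
    using cluster_positive_Sk assms(2) .
  \<comment> \<open>(A) and (B) become complementary statements about whether (M1) is attained in
    the orbit of \<open>Sk M\<close>.\<close>
  have A: "cond_A M \<longleftrightarrow> (\<exists>U\<in>Gamma_triple (Sk M). M1 U)"
    using assms(2) cond_A_triple_iff[OF S] by (simp add: cond_A_def)
  have B: "cond_B M \<longleftrightarrow> \<not> (\<exists>U\<in>Gamma_triple (Sk M). M1 U)"
    using assms(2) cond_B_triple_iff[OF S] by (simp add: cond_B_def)
  note C = markov_C_eq_triple_C[OF assms(1)]
  have a: "cond_A M \<longleftrightarrow> markov_C M < 4 \<or> (\<exists>p\<ge>2. Sk M \<in> Gamma_triple (vector [p, p, 2]) \<or>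
      Sk M \<in> Gamma_triple (vector [p, 2, p]) \<or> Sk M \<in> Gamma_triple (vector [2, p, p]))"
    unfolding A C degenerate_orbit_iff[OF S] by (rule exists_M1_iff(1)[OF S])
  have "cond_B M \<longleftrightarrow> markov_C M = 4 \<and>
      \<not> (\<exists>p\<ge>2. Sk M \<in> Gamma_triple (vector [p, p, 2]) \<or>
        Sk M \<in> Gamma_triple (vector [p, 2, p]) \<or> Sk M \<in> Gamma_triple (vector [2, p, p]))"
    unfolding B C degenerate_orbit_iff[OF S] by (rule exists_M1_iff(2)[OF S])
  then have b: "cond_B M \<longleftrightarrow> markov_C M = 4 \<and>
      (\<forall>p\<ge>2. Sk M \<notin> Gamma_triple (vector [p, p, 2]) \<and>
        Sk M \<notin> Gamma_triple (vector [p, 2, p]) \<and> Sk M \<notin> Gamma_triple (vector [2, p, p]))"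
    by blast
  have path: "\<exists>N t. descending_path M N t \<and>
      (\<forall>N' t'. descending_path M N' t' \<longrightarrow> N' = N \<and> t' = t) \<and>
      (\<exists>L. N \<longlonglongrightarrow> L \<and> (\<forall>k. gamma_array k L = L))" if "cond_B M"
    using that B by (intro descending_path_limit[OF assms(2)]) blast
  show ?thesis
    using a b path by (intro conjI impI)
qed

end
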